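(* Let $X$ be a finite topological space and let $A\subset X$. Then the exterior of $A$ is $$\operatorname{ext}(A)=\{x\in X : \text{for every } b\in X,\ b\geq x \text{ implies } b\notin A\}.$$
   Context: For a point $x$ of a finite topological space $X$, $U_x$ denotes the intersection of all open sets containing $x$, i.e. the smallest open set containing $x$. For $x,y\in X$ one writes $y\geq x$ (equivalently $x\leq y$) if $U_y\subseteq U_x$. The exterior of $A$ is $\operatorname{ext}(A)=X\setminus\overline{A}=\operatorname{int}(X\setminus A)$. *)

theory Defs
  imports "HOL-Analysis.Abstract_Topology"
begin

text \<open>Only meaningful for \<open>x \<in> topspace X\<close>; otherwise the intersection is over the empty
  family and gives \<open>UNIV\<close>.\<close>
definition minimal_nbhd :: "'a topology \<Rightarrow> 'a \<Rightarrow> 'a set" where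
  "minimal_nbhd X x = \<Inter> {U. openin X U \<and> x \<in> U}"

text \<open>The convention is \<open>x \<le> y\<close> iff \<open>U\<^sub>y \<subseteq> U\<^sub>x\<close>, so larger points have smaller
  neighbourhoods; much of the literature uses the opposite order.\<close>
definition spec_le :: "'a topology \<Rightarrow> 'a \<Rightarrow> 'a \<Rightarrow> bool" where
  "spec_le X x y \<longleftrightarrow> minimal_nbhd X y \<subseteq> minimal_nbhd X x"

definition exterior_of :: "'a topology \<Rightarrow> 'a set \<Rightarrow> 'a set" (infixr "exterior'_of" 80) where
  "X exterior_of A = topspace X - X closure_of A"

lemma exterior_of_eq_interior_of: "X exterior_of A = X interior_of (topspace X - A)"
  by (simp add: exterior_of_def interior_of_complement)

end

theory Submission
  imports Defs
begin

text \<open>In a finite space U_x is a finite intersection of open sets, hence open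
  (\<open>openin_minimal_nbhd\<close>), and so the least open neighbourhood of x. Thus b \<ge> x
  means b lies in U_x, and x lies in the closure of A iff U_x meets A; negating the latter describes
  the exterior.\<close>

lemma minimal_nbhd_subset: "openin X U \<Longrightarrow> x \<in> U \<Longrightarrow> minimal_nbhd X x \<subseteq> U"
  by (auto simp: minimal_nbhd_def)

lemma self_in_minimal_nbhd: "x \<in> minimal_nbhd X x"
  by (auto simp: minimal_nbhd_def)

lemma openin_minimal_nbhd:
  assumes "finite (topspace X)" and "x \<in> topspace X"
  shows "openin X (minimal_nbhd X x)"
  unfolding minimal_nbhd_def
proof (rule openin_Inter)
  have "{U. openin X U \<and> x \<in> U} \<subseteq> Pow (topspace X)"
    using openin_subset by blast
  then show "finite {U. openin X U \<and> x \<in> U}"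
    using assms(1) by (meson finite_Pow_iff finite_subset)
  \<comment> \<open>The whole space belongs to the family; an empty one would have intersection
    \<open>UNIV\<close>.\<close>
  show "{U. openin X U \<and> x \<in> U} \<noteq> {}"
    using assms(2) openin_topspace by blast
qed auto

text \<open>Forwards, b lies in U_b. Backwards, U_x is an open set containing b, so it contains
  U_b.\<close>

lemma spec_le_iff_in_minimal_nbhd:
  assumes "finite (topspace X)" and "x \<in> topspace X"
  shows "spec_le X x b \<longleftrightarrow> b \<in> minimal_nbhd X x"
  using minimal_nbhd_subset[OF openin_minimal_nbhd[OF assms]] self_in_minimal_nbhd[of b X]
  by (auto simp: spec_le_def)

text \<open>U_x is an open neighbourhood of x inside every other one, so it alone decides whether
  all of them meet A.\<close>

lemma in_closure_of_iff_minimal_nbhd: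
  assumes "finite (topspace X)" and "x \<in> topspace X"
  shows "x \<in> X closure_of A \<longleftrightarrow> (\<exists>b\<in>A. b \<in> minimal_nbhd X x)"
  using assms(2) openin_minimal_nbhd[OF assms] self_in_minimal_nbhd[of x X]
    minimal_nbhd_subset[of X _ x]
  unfolding in_closure_of by (meson subsetD)

theorem proposition3p10:
  fixes X :: "'a topology" and A :: "'a set"
  assumes "finite (topspace X)"
    and "A \<subseteq> topspace X"
  shows "X exterior_of A = {x \<in> topspace X. \<forall>b \<in> topspace X. spec_le X x b \<longrightarrow> b \<notin> A}"
  \<comment> \<open>This reconciles b ranging over \<open>topspace X\<close> with b ranging over
    \<open>A\<close> in the closure criterion.\<close>
  using assms(2)
  by (fastforce simp: exterior_of_def in_closure_of_iff_minimal_nbhd[OF assms(1)]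
      spec_le_iff_in_minimal_nbhd[OF assms(1)])

end
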